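(* If $G$ is a disconnected cograph without isolated vertices having $k$ connected components, then $\chi_{td}(G)=\chi(G)+2(k-1)$.
   Context: All graphs are finite, simple and undirected. A cograph is a graph with no induced path on four vertices. $\chi(G)$ is the chromatic number. A total dominator coloring (TD-coloring) of an isolate-free graph $G$ is a proper vertex coloring such that every vertex is adjacent to all vertices of some color class; $\chi_{td}(G)$ is the minimum number of colors in a TD-coloring. *)

theory Defs
  imports "Graph_Theory.Graph_Theory"
begin

text \<open>
  Finite simple undirected graphs are the locale \<open>graph\<close>: each edge \<open>uv\<close> is the pair of arcs
  \<open>u \<rightarrow> v\<close>, \<open>v \<rightarrow> u\<close>. Adjacency is therefore \<open>u \<rightarrow>\<^bsub>G\<^esub> v\<close>.
\<close>

definition cograph :: "('a, 'b) pre_digraph \<Rightarrow> bool" where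
  "cograph G \<longleftrightarrow> graph G \<and>
    \<not> (\<exists>a\<in>verts G. \<exists>b\<in>verts G. \<exists>c\<in>verts G. \<exists>d\<in>verts G.
        distinct [a, b, c, d] \<and>
        a \<rightarrow>\<^bsub>G\<^esub> b \<and> b \<rightarrow>\<^bsub>G\<^esub> c \<and> c \<rightarrow>\<^bsub>G\<^esub> d \<and>
        \<not> a \<rightarrow>\<^bsub>G\<^esub> c \<and> \<not> a \<rightarrow>\<^bsub>G\<^esub> d \<and> \<not> b \<rightarrow>\<^bsub>G\<^esub> d)"

definition isolated_vertex :: "('a, 'b) pre_digraph \<Rightarrow> 'a \<Rightarrow> bool" where
  "isolated_vertex G v \<longleftrightarrow> v \<in> verts G \<and> \<not> (\<exists>u\<in>verts G. v \<rightarrow>\<^bsub>G\<^esub> u)"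

definition connected_components :: "('a, 'b) pre_digraph \<Rightarrow> ('a, 'b) pre_digraph set" where
  "connected_components G = {H. pre_digraph.max_subgraph G Digraph_Component.connected H}"

definition proper_coloring :: "('a, 'b) pre_digraph \<Rightarrow> ('a \<Rightarrow> nat) \<Rightarrow> bool" where
  "proper_coloring G f \<longleftrightarrow> (\<forall>u\<in>verts G. \<forall>v\<in>verts G. u \<rightarrow>\<^bsub>G\<^esub> v \<longrightarrow> f u \<noteq> f v)"

text \<open>Only colors that are actually used give color classes, so every class is nonempty.\<close>

definition color_classes :: "('a, 'b) pre_digraph \<Rightarrow> ('a \<Rightarrow> nat) \<Rightarrow> 'a set set" where
  "color_classes G f = (\<lambda>c. {v \<in> verts G. f v = c}) ` f ` verts G"

definition chromatic_number :: "('a, 'b) pre_digraph \<Rightarrow> nat" where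
  "chromatic_number G = (LEAST n. \<exists>f. proper_coloring G f \<and> card (f ` verts G) = n)"

definition td_coloring :: "('a, 'b) pre_digraph \<Rightarrow> ('a \<Rightarrow> nat) \<Rightarrow> bool" where
  "td_coloring G f \<longleftrightarrow> proper_coloring G f \<and>
    (\<forall>v\<in>verts G. \<exists>C\<in>color_classes G f. \<forall>u\<in>C. v \<rightarrow>\<^bsub>G\<^esub> u)"

definition td_chromatic_number :: "('a, 'b) pre_digraph \<Rightarrow> nat" where
  "td_chromatic_number G = (LEAST n. \<exists>f. td_coloring G f \<and> card (f ` verts G) = n)"

end

theory Submission
  imports Defs
begin

text \<open>
  Every vertex dominates a color class, and this class lies in the component of the vertex. Applying
  this to a vertex and then to a member of the class it dominates gives two colors private to each
  component. So each component avoids at least \<open>2(k-1)\<close> colors, and since components can be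
  recolored independently, \<open>\<chi> \<le> \<chi>\<^sub>t\<^sub>d - 2(k-1)\<close>.

  Conversely, each component has at least two vertices and is connected and \<open>P\<^sub>4\<close>-free, hence
  its complement is disconnected, so it is a join of two nonempty parts. Given any proper coloring,
  pick a color in each part; every vertex of the component is adjacent to all vertices of the
  component having one of these two colors. Making these two colors private in every component, and
  sharing the remaining \<open>\<chi> - 2\<close> ones, uses \<open>2k + \<chi> - 2\<close> colors.
\<close>

section \<open>Joins in \<open>P\<^sub>4\<close>-free relations\<close>

definition P4_free :: "('a \<Rightarrow> 'a \<Rightarrow> bool) \<Rightarrow> 'a set \<Rightarrow> bool" where
  "P4_free R V \<longleftrightarrow> \<not> (\<exists>a\<in>V. \<exists>b\<in>V. \<exists>c\<in>V. \<exists>d\<in>V. distinct [a, b, c, d] \<and>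
     R a b \<and> R b c \<and> R c d \<and> \<not> R a c \<and> \<not> R a d \<and> \<not> R b d)"

definition separates :: "('a \<Rightarrow> 'a \<Rightarrow> bool) \<Rightarrow> 'a set \<Rightarrow> 'a set \<Rightarrow> bool" where
  "separates R V A \<longleftrightarrow> A \<noteq> {} \<and> A \<subset> V \<and> (\<forall>a\<in>A. \<forall>b\<in>V - A. \<not> R a b)"

definition separable :: "('a \<Rightarrow> 'a \<Rightarrow> bool) \<Rightarrow> 'a set \<Rightarrow> bool" where
  "separable R V \<longleftrightarrow> (\<exists>A. separates R V A)"

lemma P4_freeD:
  assumes "P4_free R V" "{a, b, c, d} \<subseteq> V" "distinct [a, b, c, d]" "R a b" "R b c" "R c d"
  shows "R a c \<or> R a d \<or> R b d"
  using assms unfolding P4_free_def by blast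

lemma P4_free_subset: "P4_free R V \<Longrightarrow> W \<subseteq> V \<Longrightarrow> P4_free R W"
  unfolding P4_free_def by blast

lemma symp_uminus: "symp R \<Longrightarrow> symp (- R)"
  by (auto simp: symp_def)

text \<open>The complement of the path \<open>a b c d\<close> is the path \<open>b d a c\<close>.\<close>

lemma P4_free_uminus:
  assumes "symp R" "P4_free R V"
  shows "P4_free (- R) V"
  unfolding P4_free_def
proof (intro notI, elim bexE conjE)
  fix a b c d
  assume V: "a \<in> V" "b \<in> V" "c \<in> V" "d \<in> V" and "distinct [a, b, c, d]"
    and R: "(- R) a b" "(- R) b c" "(- R) c d" "\<not> (- R) a c" "\<not> (- R) a d" "\<not> (- R) b d"
  then have "distinct [b, d, a, c]" "R b d" "R d a" "R a c"
    using sympD[OF assms(1)] by auto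
  then have "R b a \<or> R b c \<or> R d c"
    using P4_freeD[OF assms(2), of b d a c] V by blast
  then show False using R sympD[OF assms(1)] by auto
qed

lemma separates_Diff: "symp R \<Longrightarrow> separates R V A \<Longrightarrow> separates R V (V - A)"
  unfolding separates_def by (auto dest: sympD)

lemma separable_insert_isolated:
  assumes "v \<notin> W" "W \<noteq> {}" "\<And>w. w \<in> W \<Longrightarrow> \<not> R v w"
  shows "separable R (insert v W)"
proof -
  have "separates R (insert v W) {v}"
    using assms unfolding separates_def by blast
  then show ?thesis unfolding separable_def ..
qed

lemma separable_insert_if_nonadjacent:
  assumes sym: "symp R" and free: "P4_free R (insert v W)" and v: "v \<notin> W"
    and A: "separates R W A" and x: "x \<in> A" "\<not> R v x"
  shows "separable R (insert v W)"
proof (cases "\<exists>z\<in>W - A. R v z")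
  case False
  then have "separates R (insert v W) (W - A)"
    using separates_Diff[OF sym A] v sympD[OF sym] unfolding separates_def by blast
  then show ?thesis unfolding separable_def ..
next
  case True
  then obtain z where z: "z \<in> W - A" "R v z" ..
  define N where "N = {y \<in> A. \<not> R v y}"
  have "\<not> R a b" if a: "a \<in> N" and b: "b \<in> insert v W - N" for a b
  proof
    assume "R a b"
    then have "b \<in> A" "R v b"
      using a b A sympD[OF sym] unfolding N_def separates_def by blast+
    \<comment> \<open>\<open>z v b a\<close> would be an induced path.\<close>
    have "distinct [z, v, b, a]" "{z, v, b, a} \<subseteq> insert v W"
      using z a \<open>b \<in> A\<close> \<open>R v b\<close> A v unfolding N_def separates_def by auto
    moreover have "R z v" "R b a" "\<not> R z b" "\<not> R z a" "\<not> R v a"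
      using z a \<open>b \<in> A\<close> \<open>R a b\<close> A sympD[OF sym] unfolding N_def separates_def by blast+
    ultimately show False
      using P4_freeD[OF free, of z v b a] \<open>R v b\<close> by blast
  qed
  moreover have "N \<noteq> {}" "N \<subset> insert v W"
    using x A v unfolding N_def separates_def by blast+
  ultimately show ?thesis unfolding separable_def separates_def by blast
qed

lemma P4_free_insert_separable:
  assumes sym: "symp R" and free: "P4_free R (insert v W)" and v: "v \<notin> W" and sep: "separable R W"
  shows "separable R (insert v W) \<or> separable (- R) (insert v W)"
proof -
  obtain A where A: "separates R W A" using sep unfolding separable_def ..
  show ?thesis
  proof (cases "\<exists>x\<in>W. \<not> R v x")
    case True
    then obtain x where "x \<in> A \<or> x \<in> W - A" "\<not> R v x" by blast
    then have "separable R (insert v W)"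
      using separable_insert_if_nonadjacent[OF sym free v] A separates_Diff[OF sym A] by blast
    then show ?thesis ..
  next
    case False
    moreover have "W \<noteq> {}" using A unfolding separates_def by blast
    ultimately have "separable (- R) (insert v W)"
      using v by (intro separable_insert_isolated) auto
    then show ?thesis ..
  qed
qed

lemma P4_free_separable_or_complement_separable:
  assumes "finite V" "V \<noteq> {}" "\<not> is_singleton V" "symp R" "P4_free R V"
  shows "separable R V \<or> separable (- R) V"
  using assms(1-3,5)
proof (induction V rule: finite_ne_induct)
  case (singleton v)
  then show ?case by (simp add: is_singleton_def)
next
  case (insert v W)
  have free: "P4_free R (insert v W)" "P4_free (- R) (insert v W)"
    using insert.prems(2) P4_free_uminus[OF \<open>symp R\<close>] by blast+
  have "P4_free R W" using free(1) by (rule P4_free_subset) blast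
  with insert.IH consider w where "W = {w}" | "separable R W" | "separable (- R) W"
    unfolding is_singleton_def by blast
  then show ?case
  proof cases
    case 1
    moreover have "\<not> R v w \<or> \<not> (- R) v w" by simp
    ultimately show ?thesis
      using separable_insert_isolated[of v W R] separable_insert_isolated[of v W "- R"]
        insert.hyps by blast
  next
    case 2
    then show ?thesis
      using P4_free_insert_separable[OF \<open>symp R\<close> free(1)] insert.hyps by blast
  next
    case 3
    then show ?thesis
      using P4_free_insert_separable[OF symp_uminus[OF \<open>symp R\<close>] free(2)] insert.hyps
      unfolding double_compl by blast
  qed
qed

lemma cograph_iff: "cograph G \<longleftrightarrow> graph G \<and> P4_free (dominates G) (verts G)"
  unfolding cograph_def P4_free_def ..

section \<open>Connected components\<close>

lemma (in pre_digraph) max_subgraph_iff_induced_subgraph: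
  assumes mono: "arc_mono P"
  shows "max_subgraph P H \<longleftrightarrow> induced_subgraph H G \<and> P H \<and>
    \<not> (\<exists>K. induced_subgraph K G \<and> P K \<and> verts H \<subset> verts K)" (is "?max \<longleftrightarrow> ?ind \<and> P H \<and> \<not> ?larger")
proof (intro iffI conjI notI)
  assume max: ?max
  then show ?ind using mono by (rule induced_subgraphI_arc_mono)
  show "P H" using max by (rule max_subgraph_prop)
  assume ?larger
  then obtain K where K: "induced_subgraph K G" "P K" "verts H \<subset> verts K" by blast
  then have "subgraph H K"
    using \<open>?ind\<close> by (auto simp: induced_subgraph_def subgraph_def compatible_def)
  moreover have "K \<noteq> H" "subgraph K G" using K induced_imp_subgraph by blast+
  ultimately show False using max \<open>P K\<close> unfolding max_subgraph_def by blast
next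
  assume H: "?ind \<and> P H \<and> \<not> ?larger"
  show ?max
  proof (rule max_subgraphI)
    show "P H" "subgraph H G" using H induced_imp_subgraph by blast+
    fix K assume K: "H \<noteq> K" "subgraph H K" "subgraph K G"
    then have "verts H \<subset> verts K"
      using H by (auto simp: induced_subgraph_altdef2 max_subgraph_def)
    moreover have "induced_subgraph (G \<restriction> verts K) G"
      using K(3) wf_digraph.induced_induce unfolding subgraph_def by blast
    ultimately have "\<not> P (G \<restriction> verts K)"
      using H by (metis induce_subgraph_verts)
    then show "\<not> P K"
      using mono subgraph_induce_subgraphI2[OF K(3)] unfolding arc_mono_def
      by (metis induce_subgraph_verts)
  qed
qed

lemma arc_mono_connected: "arc_mono Digraph_Component.connected"
  unfolding arc_mono_def
  by (metis spanning_def subgraph_def wf_digraph.connected_spanning_imp_connected)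

lemma (in sym_digraph) connected_iff_strongly_connected:
  "Digraph_Component.connected G \<longleftrightarrow> strongly_connected G"
  using symmetric_connected_imp_strongly_connected[OF sym_arcs]
  by (auto simp: strongly_connected_def intro!: connectedI reachable_mk_symmetricI)

context sym_digraph
begin

lemma connected_components_eq_sccs: "connected_components G = sccs"
proof -
  have "Digraph_Component.connected H \<longleftrightarrow> strongly_connected H" if "induced_subgraph H G" for H
  proof -
    interpret H: sym_digraph H using that by (rule induced_graph_imp_graph)
    show ?thesis by (rule H.connected_iff_strongly_connected)
  qed
  then show ?thesis
    unfolding connected_components_def sccs_def
      max_subgraph_iff_induced_subgraph[OF arc_mono_connected]
    by blast
qed

lemma card_connected_components: "card (connected_components G) = card sccs_verts"
  by (simp add: connected_components_eq_sccs card_sccs_verts)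

lemma symp_dominates: "symp (dominates G)"
  using sym_arcs by (auto simp: symmetric_def symp_def dest: symD)

lemma scc_of_eq_if_in_sccs_verts: "C \<in> sccs_verts \<Longrightarrow> v \<in> C \<Longrightarrow> scc_of v = C"
  unfolding sccs_verts_conv_scc_of by (auto dest: scc_of_eq)

lemma scc_of_eq_if_adj: "u \<rightarrow>\<^bsub>G\<^esub> v \<Longrightarrow> scc_of u = scc_of v"
  by (intro scc_of_eq scc_ofI_reachable) blast

lemma sccs_verts_adj_closed:
  assumes "C \<in> sccs_verts" "u \<in> C" "u \<rightarrow>\<^bsub>G\<^esub> v"
  shows "v \<in> C"
  using assms scc_of_eq_if_in_sccs_verts scc_of_eq_if_adj in_scc_of_self adj_in_verts(2) by metis

lemma sccs_verts_not_separable: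
  assumes C: "C \<in> sccs_verts"
  shows "\<not> separable (dominates G) C"
proof
  assume "separable (dominates G) C"
  then obtain A where A: "A \<noteq> {}" "A \<subset> C" "\<forall>a\<in>A. \<forall>b\<in>C - A. \<not> a \<rightarrow>\<^bsub>G\<^esub> b"
    unfolding separable_def separates_def by blast
  then obtain a b where ab: "a \<in> A" "b \<in> C - A" by blast
  then have "a \<rightarrow>\<^sup>*\<^bsub>G\<^esub> b" using C A(2) by (auto simp: in_sccs_verts_conv_reachable)
  then have "b \<in> A"
  proof (induction rule: reachable_induct)
    case base
    then show ?case using ab by simp
  next
    case (step x y)
    then show ?case using sccs_verts_adj_closed[OF C, of x y] A by blast
  qed
  then show False using ab by blast
qed

end

section \<open>Colorings\<close>

definition dominates_color :: "('a, 'b) pre_digraph \<Rightarrow> ('a \<Rightarrow> 'c) \<Rightarrow> 'a set \<Rightarrow> 'a \<Rightarrow> 'c \<Rightarrow> bool" where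
  "dominates_color G f S v c \<longleftrightarrow> (\<forall>u\<in>S. f u = c \<longrightarrow> v \<rightarrow>\<^bsub>G\<^esub> u)"

lemma proper_coloringD:
  "proper_coloring G f \<Longrightarrow> u \<in> verts G \<Longrightarrow> v \<in> verts G \<Longrightarrow> u \<rightarrow>\<^bsub>G\<^esub> v \<Longrightarrow> f u \<noteq> f v"
  by (simp add: proper_coloring_def)

lemma td_coloring_iff:
  "td_coloring G f \<longleftrightarrow> proper_coloring G f \<and>
    (\<forall>v\<in>verts G. \<exists>c\<in>f ` verts G. dominates_color G f (verts G) v c)"
  by (simp add: td_coloring_def color_classes_def dominates_color_def Ball_def imp_conjL)

lemma (in digraph) proper_coloring_exists: "\<exists>f. proper_coloring G f"
proof -
  obtain f :: "'a \<Rightarrow> nat" where "inj_on f (verts G)"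
    using finite_imp_inj_to_nat_seg[OF finite_verts] by blast
  then have "proper_coloring G f"
    using adj_not_same unfolding proper_coloring_def inj_on_def by blast
  then show ?thesis by blast
qed

lemma chromatic_number_le: "proper_coloring G f \<Longrightarrow> chromatic_number G \<le> card (f ` verts G)"
  unfolding chromatic_number_def by (rule Least_le) auto

lemma (in digraph) chromatic_number_attained:
  "\<exists>f. proper_coloring G f \<and> card (f ` verts G) = chromatic_number G"
  unfolding chromatic_number_def by (rule LeastI_ex) (use proper_coloring_exists in auto)

lemma td_chromatic_number_le: "td_coloring G f \<Longrightarrow> td_chromatic_number G \<le> card (f ` verts G)"
  unfolding td_chromatic_number_def by (rule Least_le) auto

lemma td_chromatic_number_attained:
  "td_coloring G g \<Longrightarrow> \<exists>f. td_coloring G f \<and> card (f ` verts G) = td_chromatic_number G"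
  unfolding td_chromatic_number_def by (rule LeastI_ex) auto

lemma (in sym_digraph) recolor_components_neq:
  assumes f: "proper_coloring G f" and inj: "inj_on (h (scc_of u)) (f ` scc_of u)"
    and adj: "u \<rightarrow>\<^bsub>G\<^esub> v"
  shows "h (scc_of u) (f u) \<noteq> h (scc_of v) (f v)"
proof -
  have uv: "u \<in> verts G" "v \<in> verts G" using adj adj_in_verts by blast+
  then have "f u \<noteq> f v" using adj by (rule proper_coloringD[OF f])
  moreover have eq: "scc_of u = scc_of v" using adj by (rule scc_of_eq_if_adj)
  moreover have "u \<in> scc_of u" "v \<in> scc_of u" using uv in_scc_of_self eq by auto
  ultimately show ?thesis using inj by (auto dest: inj_onD)
qed

section \<open>The lower bound\<close>

lemma (in pseudo_graph) chromatic_number_le_if_components: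
  assumes f: "proper_coloring G f" and bound: "\<And>C. C \<in> sccs_verts \<Longrightarrow> card (f ` C) \<le> n"
  shows "chromatic_number G \<le> n"
proof -
  have "\<exists>h. inj_on h (f ` C) \<and> h ` f ` C \<subseteq> {..<n}" if "C \<in> sccs_verts" for C
    using card_le_inj[of "f ` C" "{..<n}"] bound[OF that] sccs_verts_subsets[OF that]
      finite_subset[OF _ finite_verts] by auto
  then obtain h where h: "\<And>C. C \<in> sccs_verts \<Longrightarrow> inj_on (h C) (f ` C) \<and> h C ` f ` C \<subseteq> {..<n}"
    by metis
  define g where "g v = h (scc_of v) (f v)" for v
  have "proper_coloring G g"
    using recolor_components_neq[OF f, of h] h scc_of_in_sccs_verts
    unfolding proper_coloring_def g_def by blast
  then have "chromatic_number G \<le> card (g ` verts G)" by (rule chromatic_number_le)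
  also have "\<dots> \<le> card {..<n}"
    using h scc_of_in_sccs_verts in_scc_of_self unfolding g_def by (intro card_mono) blast+
  finally show ?thesis by simp
qed

definition private_colors :: "('a \<Rightarrow> 'c) \<Rightarrow> 'a set \<Rightarrow> 'a set \<Rightarrow> 'c set" where
  "private_colors f V C = f ` C - f ` (V - C)"

lemma card_image_add_private_colors_le:
  assumes fin: "finite V" "finite \<C>" and sub: "\<Union>\<C> \<subseteq> V" and disj: "disjoint \<C>" and C: "C \<in> \<C>"
  shows "card (f ` C) + (\<Sum>D\<in>\<C> - {C}. card (private_colors f V D)) \<le> card (f ` V)"
proof -
  let ?Q = "\<Union>D\<in>\<C> - {C}. private_colors f V D"
  have finite_image: "finite (f ` D)" if "D \<in> \<C>" for D
    using that sub by (intro finite_imageI finite_subset[OF _ fin(1)]) blast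
  have disjoint_image: "private_colors f V D \<inter> f ` E = {}" if "D \<in> \<C>" "E \<in> \<C>" "D \<noteq> E" for D E
  proof -
    have "E \<subseteq> V - D" using that sub disjointD[OF disj] by blast
    then show ?thesis unfolding private_colors_def by blast
  qed
  have "card ?Q = (\<Sum>D\<in>\<C> - {C}. card (private_colors f V D))"
  proof (rule card_UN_disjoint)
    show "\<forall>D\<in>\<C> - {C}. \<forall>E\<in>\<C> - {C}. D \<noteq> E \<longrightarrow> private_colors f V D \<inter> private_colors f V E = {}"
      using disjoint_image unfolding private_colors_def by blast
  qed (use fin finite_image in \<open>auto simp: private_colors_def\<close>)
  moreover have "card (f ` C \<union> ?Q) = card (f ` C) + card ?Q"
  proof (rule card_Un_disjoint)
    show "f ` C \<inter> ?Q = {}" using C disjoint_image by blast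
  qed (use C fin(2) finite_image in \<open>auto simp: private_colors_def\<close>)
  moreover have "card (f ` C \<union> ?Q) \<le> card (f ` V)"
    using C sub fin(1) by (intro card_mono) (auto simp: private_colors_def)
  ultimately show ?thesis by simp
qed

lemma (in pseudo_graph) two_le_card_private_colors:
  assumes td: "td_coloring G f" and C: "C \<in> sccs_verts"
  shows "2 \<le> card (private_colors f (verts G) C)"
proof -
  have proper: "proper_coloring G f" using td by (simp add: td_coloring_iff)
  have sub: "C \<subseteq> verts G" using C by (rule sccs_verts_subsets)
  have dominated: "\<exists>u\<in>C. v \<rightarrow>\<^bsub>G\<^esub> u \<and> f u \<in> private_colors f (verts G) C" if v: "v \<in> C" for v
  proof -
    have "v \<in> verts G" using v sub by blast
    then obtain u where u: "u \<in> verts G" "\<And>w. w \<in> verts G \<Longrightarrow> f w = f u \<Longrightarrow> v \<rightarrow>\<^bsub>G\<^esub> w"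
      using td unfolding td_coloring_iff dominates_color_def by blast
    then have "w \<in> C" if "w \<in> verts G" "f w = f u" for w
      using that sccs_verts_adj_closed[OF C v] by blast
    then show ?thesis using u unfolding private_colors_def by force
  qed
  obtain v where "v \<in> C" using C by (auto simp: in_sccs_verts_conv_reachable)
  then obtain u where u: "u \<in> C" "f u \<in> private_colors f (verts G) C"
    using dominated by blast
  then obtain w where w: "w \<in> C" "u \<rightarrow>\<^bsub>G\<^esub> w" "f w \<in> private_colors f (verts G) C"
    using dominated by blast
  have "f u \<noteq> f w" using proper_coloringD[OF proper] u w sub by blast
  then have "2 = card {f u, f w}" by simp
  also have "\<dots> \<le> card (private_colors f (verts G) C)"
    using u w sub finite_subset[OF sub finite_verts]
    by (intro card_mono) (auto simp: private_colors_def)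
  finally show ?thesis .
qed

lemma (in pseudo_graph) chromatic_number_add_le_card_td_coloring:
  assumes td: "td_coloring G f" and ne: "verts G \<noteq> {}"
  shows "chromatic_number G + 2 * (card sccs_verts - 1) \<le> card (f ` verts G)"
proof -
  let ?k = "card sccs_verts"
  have bound: "card (f ` C) + 2 * (?k - 1) \<le> card (f ` verts G)" if C: "C \<in> sccs_verts" for C
  proof -
    have "2 * (?k - 1) = (\<Sum>D\<in>sccs_verts - {C}. 2)"
      using C finite_sccs_verts by simp
    also have "\<dots> \<le> (\<Sum>D\<in>sccs_verts - {C}. card (private_colors f (verts G) D))"
      using two_le_card_private_colors[OF td] by (intro sum_mono) blast
    finally show ?thesis
      using card_image_add_private_colors_le[OF finite_verts finite_sccs_verts _ _ C, of f]
        sccs_verts_subsets sccs_verts_disjoint by (force simp: disjoint_def)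
  qed
  have "chromatic_number G \<le> card (f ` verts G) - 2 * (?k - 1)"
    using bound td by (intro chromatic_number_le_if_components) (force simp: td_coloring_iff)+
  moreover have "2 * (?k - 1) \<le> card (f ` verts G)"
    using bound ne unfolding sccs_verts_conv_scc_of by fastforce
  ultimately show ?thesis by simp
qed

section \<open>The upper bound\<close>

lemma (in fin_digraph) td_coloring_relabel_nat:
  fixes f :: "'a \<Rightarrow> 'c"
  assumes proper: "\<And>u v. u \<rightarrow>\<^bsub>G\<^esub> v \<Longrightarrow> f u \<noteq> f v"
    and dom: "\<And>v. v \<in> verts G \<Longrightarrow> \<exists>c\<in>f ` verts G. dominates_color G f (verts G) v c"
  obtains g where "td_coloring G g" "card (g ` verts G) = card (f ` verts G)"
proof -
  obtain e :: "'c \<Rightarrow> nat" where e: "inj_on e (f ` verts G)"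
    using finite_imp_inj_to_nat_seg[of "f ` verts G"] finite_verts by blast
  then have eq_iff: "e (f u) = e (f v) \<longleftrightarrow> f u = f v" if "u \<in> verts G" "v \<in> verts G" for u v
    using that by (auto dest: inj_onD)
  have "td_coloring G (\<lambda>v. e (f v))"
    unfolding td_coloring_iff
  proof (intro conjI ballI)
    show "proper_coloring G (\<lambda>v. e (f v))"
      using proper eq_iff by (auto simp: proper_coloring_def)
    fix v assume "v \<in> verts G"
    then obtain w where "w \<in> verts G" "dominates_color G f (verts G) v (f w)"
      using dom by blast
    then show "\<exists>c\<in>(\<lambda>v. e (f v)) ` verts G. dominates_color G (\<lambda>v. e (f v)) (verts G) v c"
      using eq_iff unfolding dominates_color_def by blast
  qed
  moreover have "card ((\<lambda>v. e (f v)) ` verts G) = card (f ` verts G)"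
    using card_image[OF e] by (simp add: image_image)
  ultimately show thesis by (rule that)
qed

text \<open>Each component \<open>C\<close> keeps the colors in \<open>D C\<close> for itself and injects its other colors into a
  common palette by \<open>r C\<close>.\<close>

definition privatize ::
    "('i \<Rightarrow> 'c set) \<Rightarrow> ('i \<Rightarrow> 'c \<Rightarrow> 'd) \<Rightarrow> 'i \<Rightarrow> 'c \<Rightarrow> 'i \<times> 'c + 'd" where
  "privatize D r C c = (if c \<in> D C then Inl (C, c) else Inr (r C c))"

lemma privatize_eq_Inl_iff: "privatize D r C c = Inl (C', c') \<longleftrightarrow> C = C' \<and> c = c' \<and> c \<in> D C"
  by (auto simp: privatize_def)

lemma inj_on_privatize: "inj_on (r C) (S - D C) \<Longrightarrow> inj_on (privatize D r C) S"
  by (auto simp: inj_on_def privatize_def)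

lemma card_privatize_le:
  assumes fin: "finite \<C>" "finite S" and ne: "\<C> \<noteq> {}"
    and D: "\<And>C. C \<in> \<C> \<Longrightarrow> D C \<subseteq> S" "\<And>C. C \<in> \<C> \<Longrightarrow> card (D C) = m"
    and r: "\<And>C. C \<in> \<C> \<Longrightarrow> r C ` (S - D C) \<subseteq> {..<card S - m}"
  shows "card (\<Union>C\<in>\<C>. privatize D r C ` S) \<le> card S + m * (card \<C> - 1)"
proof -
  have finite_D: "finite (D C)" if "C \<in> \<C>" for C
    using D(1)[OF that] fin(2) by (rule finite_subset)
  have "(\<Union>C\<in>\<C>. privatize D r C ` S) \<subseteq> Sigma \<C> D <+> {..<card S - m}"
    using r by (auto simp: privatize_def)
  then have "card (\<Union>C\<in>\<C>. privatize D r C ` S) \<le> card (Sigma \<C> D <+> {..<card S - m})"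
    using fin finite_D by (intro card_mono) auto
  also have "\<dots> = card \<C> * m + (card S - m)"
    using fin finite_D D(2) by (simp add: card_Plus)
  also have "\<dots> = card S + m * (card \<C> - 1)"
  proof -
    have "0 < card \<C>" using fin(1) ne by (simp add: card_gt_0_iff)
    moreover have "m \<le> card S" using ne D card_mono[OF fin(2)] by blast
    ultimately show ?thesis by (cases "card \<C>") auto
  qed
  finally show ?thesis .
qed

lemma (in sym_digraph) ex_dominates_color_privatize:
  fixes D r f
  defines "F \<equiv> \<lambda>v. privatize D r (scc_of v) (f v)"
  assumes v: "v \<in> verts G" and D: "D (scc_of v) \<subseteq> f ` scc_of v"
    and dom: "\<exists>c\<in>D (scc_of v). dominates_color G f (scc_of v) v c"
  shows "\<exists>c\<in>F ` verts G. dominates_color G F (verts G) v c"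
proof -
  obtain w where w: "w \<in> scc_of v" "f w \<in> D (scc_of v)" "dominates_color G f (scc_of v) v (f w)"
    using dom D by blast
  then have "F w = Inl (scc_of v, f w)"
    using scc_of_eq by (simp add: F_def privatize_eq_Inl_iff)
  have "dominates_color G F (verts G) v (Inl (scc_of v, f w))"
    using w(3) in_scc_of_self by (auto simp: F_def dominates_color_def privatize_eq_Inl_iff)
  moreover have "w \<in> verts G"
    using w(1) sccs_verts_subsets[OF scc_of_in_sccs_verts[OF v]] by blast
  ultimately show ?thesis using \<open>F w = _\<close> by force
qed

lemma (in pseudo_graph) td_coloring_if_components_dominate:
  assumes f: "proper_coloring G f" and ne: "verts G \<noteq> {}"
    and D: "\<And>C. C \<in> sccs_verts \<Longrightarrow> D C \<subseteq> f ` C" "\<And>C. C \<in> sccs_verts \<Longrightarrow> card (D C) = m"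
    and dom: "\<And>C v. C \<in> sccs_verts \<Longrightarrow> v \<in> C \<Longrightarrow> \<exists>c\<in>D C. dominates_color G f C v c"
  obtains g where "td_coloring G g"
    "card (g ` verts G) \<le> card (f ` verts G) + m * (card sccs_verts - 1)"
proof -
  let ?S = "f ` verts G"
  have finite_S: "finite ?S" using finite_verts by simp
  have D_sub: "D C \<subseteq> ?S" if "C \<in> sccs_verts" for C
    using D(1) sccs_verts_subsets that by blast
  have "\<exists>r. inj_on r (?S - D C) \<and> r ` (?S - D C) \<subseteq> {..<card ?S - m}" if C: "C \<in> sccs_verts" for C
    using card_le_inj[of "?S - D C" "{..<card ?S - m}"] finite_S D(2)[OF C]
      card_Diff_subset[OF finite_subset[OF D_sub[OF C] finite_S] D_sub[OF C]] by auto
  then obtain r where r: "\<And>C. C \<in> sccs_verts \<Longrightarrow>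
      inj_on (r C) (?S - D C) \<and> r C ` (?S - D C) \<subseteq> {..<card ?S - m}"
    by metis
  define F where "F v = privatize D r (scc_of v) (f v)" for v
  have "F u \<noteq> F v" if adj: "u \<rightarrow>\<^bsub>G\<^esub> v" for u v
  proof -
    have C: "scc_of u \<in> sccs_verts" using adj scc_of_in_sccs_verts adj_in_verts(1) by blast
    then have "inj_on (privatize D r (scc_of u)) ?S" using r by (intro inj_on_privatize) blast
    then have "inj_on (privatize D r (scc_of u)) (f ` scc_of u)"
      by (rule inj_on_subset) (use sccs_verts_subsets[OF C] in blast)
    then show ?thesis unfolding F_def using adj by (rule recolor_components_neq[OF f])
  qed
  moreover have "\<exists>c\<in>F ` verts G. dominates_color G F (verts G) v c" if "v \<in> verts G" for v
    unfolding F_def using that D(1) dom scc_of_in_sccs_verts in_scc_of_self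
    by (intro ex_dominates_color_privatize) blast+
  ultimately obtain g where g: "td_coloring G g" "card (g ` verts G) = card (F ` verts G)"
    by (rule td_coloring_relabel_nat)
  have "card (F ` verts G) \<le> card (\<Union>C\<in>sccs_verts. privatize D r C ` ?S)"
    using scc_of_in_sccs_verts finite_sccs_verts finite_S
    unfolding F_def by (intro card_mono) auto
  also have "\<dots> \<le> card ?S + m * (card sccs_verts - 1)"
    using r D(2) D_sub finite_sccs_verts finite_S ne
    by (intro card_privatize_le) (auto simp: sccs_verts_conv_scc_of)
  finally show thesis using g that by simp
qed

lemma (in sym_digraph) dominating_color_pair_if_complement_separable:
  assumes f: "proper_coloring G f" and sub: "C \<subseteq> verts G" and sep: "separable (- dominates G) C"
  shows "\<exists>D\<subseteq>f ` C. card D = 2 \<and> (\<forall>v\<in>C. \<exists>c\<in>D. dominates_color G f C v c)"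
proof -
  obtain A where A: "A \<noteq> {}" "A \<subset> C" "\<And>a b. a \<in> A \<Longrightarrow> b \<in> C - A \<Longrightarrow> a \<rightarrow>\<^bsub>G\<^esub> b"
    using sep unfolding separable_def separates_def by auto
  then obtain a b where ab: "a \<in> A" "b \<in> C - A" by blast
  have neq: "f x \<noteq> f y" if "x \<in> A" "y \<in> C - A" for x y
    using proper_coloringD[OF f _ _ A(3)[OF that]] that A(2) sub by blast
  have "dominates_color G f C v (f b)" if v: "v \<in> A" for v
    unfolding dominates_color_def using A(3)[OF v] neq[OF _ ab(2)] by blast
  moreover have "dominates_color G f C v (f a)" if v: "v \<in> C - A" for v
    unfolding dominates_color_def
  proof (intro ballI impI)
    fix u assume "u \<in> C" "f u = f a"
    then have "u \<in> A" using neq[OF ab(1), of u] by auto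
    then show "v \<rightarrow>\<^bsub>G\<^esub> u" using sympD[OF symp_dominates A(3)[OF _ v]] by blast
  qed
  ultimately show ?thesis
    using ab A(2) neq[OF ab] by (intro exI[of _ "{f a, f b}"]) auto
qed

lemma cograph_component_complement_separable:
  assumes cog: "cograph G" and iso: "\<not> (\<exists>v. isolated_vertex G v)"
    and C: "C \<in> pre_digraph.sccs_verts G"
  shows "separable (- dominates G) C"
proof -
  interpret graph G using cog by (simp add: cograph_iff)
  have sub: "C \<subseteq> verts G" using C by (rule sccs_verts_subsets)
  obtain v where v: "v \<in> C" using C by (auto simp: in_sccs_verts_conv_reachable)
  then obtain w where "v \<rightarrow>\<^bsub>G\<^esub> w" using iso sub unfolding isolated_vertex_def by blast
  then have "w \<in> C" "w \<noteq> v" using sccs_verts_adj_closed[OF C v] adj_not_same by auto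
  then have "C \<noteq> {}" "\<not> is_singleton C" using v by (auto simp: is_singleton_def)
  moreover have "P4_free (dominates G) C"
    using cog sub P4_free_subset unfolding cograph_iff by blast
  ultimately have "separable (dominates G) C \<or> separable (- dominates G) C"
    using finite_subset[OF sub finite_verts] symp_dominates
    by (intro P4_free_separable_or_complement_separable)
  then show ?thesis using sccs_verts_not_separable[OF C] by blast
qed

lemma cograph_td_coloring:
  assumes cog: "cograph G" and iso: "\<not> (\<exists>v. isolated_vertex G v)"
    and f: "proper_coloring G f" and ne: "verts G \<noteq> {}"
  obtains g where "td_coloring G g"
    "card (g ` verts G) \<le> card (f ` verts G) + 2 * (card (pre_digraph.sccs_verts G) - 1)"
proof -
  interpret graph G using cog by (simp add: cograph_iff)
  have "\<exists>D\<subseteq>f ` C. card D = 2 \<and> (\<forall>v\<in>C. \<exists>c\<in>D. dominates_color G f C v c)"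
    if "C \<in> sccs_verts" for C
    using dominating_color_pair_if_complement_separable[OF f sccs_verts_subsets[OF that]]
      cograph_component_complement_separable[OF cog iso that] by blast
  then obtain D where D: "\<And>C. C \<in> sccs_verts \<Longrightarrow>
      D C \<subseteq> f ` C \<and> card (D C) = 2 \<and> (\<forall>v\<in>C. \<exists>c\<in>D C. dominates_color G f C v c)"
    by metis
  show thesis
    by (rule td_coloring_if_components_dominate[OF f ne, where D = D and m = 2])
      (use D that in auto)
qed

theorem theorem6:
  fixes G :: "('a, 'b) pre_digraph" and k :: nat
  assumes "cograph G"
    and "verts G \<noteq> {}"
    and "\<not> Digraph_Component.connected G"
    and "\<not> (\<exists>v. isolated_vertex G v)"
    and "k = card (connected_components G)"
  shows "td_chromatic_number G = chromatic_number G + 2 * (k - 1)"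
proof -
  interpret graph G using assms(1) by (simp add: cograph_iff)
  have k: "k = card sccs_verts" using assms(5) card_connected_components by simp
  obtain f where f: "proper_coloring G f" "card (f ` verts G) = chromatic_number G"
    using chromatic_number_attained by blast
  obtain g where g: "td_coloring G g" "card (g ` verts G) \<le> chromatic_number G + 2 * (k - 1)"
    using cograph_td_coloring[OF assms(1,4) f(1) assms(2)] unfolding f(2) k by blast
  obtain h where h: "td_coloring G h" "card (h ` verts G) = td_chromatic_number G"
    using td_chromatic_number_attained[OF g(1)] by blast
  show ?thesis
  proof (rule antisym)
    show "td_chromatic_number G \<le> chromatic_number G + 2 * (k - 1)"
      using td_chromatic_number_le[OF g(1)] g(2) by (rule order_trans)
    show "chromatic_number G + 2 * (k - 1) \<le> td_chromatic_number G"
      using chromatic_number_add_le_card_td_coloring[OF h(1) assms(2)] unfolding h(2) k .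
  qed
qed

end
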